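(* Let $r\ge1$ and $n\ge2$ be integers. Given $(\mathbf{i}=(i_1,\dots,i_n),\tau,\varepsilon_1)\in\mathfrak{T}_{r,n}$, define $$\mathcal{S}(\mathbf{i},\tau,\varepsilon_1)=(\varepsilon_1i_{\tau(1)},\ \varepsilon_2i_{\tau(2)},\ \dots,\ \varepsilon_ni_{\tau(n)})\in\mathfrak{S}_{r,n},$$ where for $j\in[2,n]$, $\varepsilon_j=-1$ if $j\in\tau(+)$ and $\varepsilon_j=1$ if $j\in\tau(-)$. Then the map $\mathcal{S}:\mathfrak{T}_{r,n}\to\mathfrak{S}_{r,n}$ is bijective, and its inverse is given by $$\mathcal{T}:\mathfrak{S}_{r,n}\to\mathfrak{T}_{r,n},\qquad \mathbf{i}^\dagger\mapsto\mathcal{T}(\mathbf{i}^\dagger):=(\mathbf{i},\tau,\varepsilon_1),$$ where $\mathbf{i}=((\mathbf{i}^\dagger_+)^{-1},-\mathbf{i}^\dagger_-)$, $\tau=\tau_{\mathbf{i}^\dagger}$, and $\varepsilon_1=\mathrm{sign}(i_1^\dagger)$.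
   Context: $[a,b]$ is the set of integers between $a$ and $b$. $\Xi_n\subset S_n$ is the set of all $\tau$ such that $\tau([1,j])$ is an interval of integers for each $j\in[1,n]$; for $\tau\in\Xi_n$, $\tau(+)=\{j\in[2,n]:\tau(j)>\tau(1)\}$ and $\tau(-)=\{j\in[2,n]:\tau(j)<\tau(1)\}$. $\mathfrak{S}_{r,n}$ is the set of signed words: sequences $\mathbf{i}^\dagger=(i_1^\dagger,\dots,i_n^\dagger)$ with $i_j^\dagger\in[-r,-1]\sqcup[1,r]$. $\mathfrak{T}_{r,n}$ is the set of triples $(\mathbf{i},\tau,\varepsilon_1)$ with $\mathbf{i}=(i_1,\dots,i_n)\in[1,r]^n$, $\tau\in\Xi_n$, $\varepsilon_1\in\{1,-1\}$. For $\mathbf{i}^\dagger\in\mathfrak{S}_{r,n}$ let $a_1<\dots<a_m$ be the positions $a$ with $i_a^\dagger>0$ and $b_1<\dots<b_{n-m}$ the positions $b$ with $i_b^\dagger<0$. Then $(\mathbf{i}^\dagger_+)^{-1}=(i^\dagger_{a_m},\dots,i^\dagger_{a_1})$, $-\mathbf{i}^\dagger_-=(-i^\dagger_{b_1},\dots,-i^\dagger_{b_{n-m}})$ (and $((\mathbf{i}^\dagger_+)^{-1},-\mathbf{i}^\dagger_-)$ is their concatenation), and $\tau_{\mathbf{i}^\dagger}\in S_n$ is the permutation with $\tau_{\mathbf{i}^\dagger}(a_t)=m+1-t$ for $t\in[1,m]$ and $\tau_{\mathbf{i}^\dagger}(b_t)=m+t$ for $t\in[1,n-m]$; one has $\tau_{\mathbf{i}^\dagger}\in\Xi_n$.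 *)

theory Defs
  imports Main "HOL-Combinatorics.Permutations"
begin

text \<open>
  Words are lists, while positions are numbered from 1: the \<open>j\<close>-th letter of \<open>w\<close>
  is \<open>w ! (j - 1)\<close>. Elements of the symmetric group on \<open>n\<close> letters are functions
  \<open>nat \<Rightarrow> nat\<close> permuting \<open>{1..n}\<close>, i.e. equal to the identity elsewhere.
\<close>

definition letter :: "'a list \<Rightarrow> nat \<Rightarrow> 'a" where
  "letter w j = w ! (j - 1)"

definition Xi :: "nat \<Rightarrow> (nat \<Rightarrow> nat) set" where
  "Xi n = {\<tau>. \<tau> permutes {1..n} \<and> (\<forall>j\<in>{1..n}. \<exists>a b. \<tau> ` {1..j} = {a..b})}"

definition tau_plus :: "nat \<Rightarrow> (nat \<Rightarrow> nat) \<Rightarrow> nat set" where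
  "tau_plus n \<tau> = {j \<in> {2..n}. \<tau> j > \<tau> 1}"

definition tau_minus :: "nat \<Rightarrow> (nat \<Rightarrow> nat) \<Rightarrow> nat set" where
  "tau_minus n \<tau> = {j \<in> {2..n}. \<tau> j < \<tau> 1}"

definition signed_words :: "nat \<Rightarrow> nat \<Rightarrow> int list set" where
  "signed_words r n = {w. length w = n \<and> set w \<subseteq> {- int r..- 1} \<union> {1..int r}}"

definition word_triples :: "nat \<Rightarrow> nat \<Rightarrow> (int list \<times> (nat \<Rightarrow> nat) \<times> int) set" where
  "word_triples r n =
     {i. length i = n \<and> set i \<subseteq> {1..int r}} \<times> Xi n \<times> {1, - 1}"

text \<open>
  The sets \<open>tau_plus n \<tau>\<close> and \<open>tau_minus n \<tau>\<close> partition \<open>{2..n}\<close> when \<open>\<tau>\<close> is injective,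
  so the last branch is not reached for \<open>j \<in> {1..n}\<close>.
\<close>

definition eps :: "nat \<Rightarrow> (nat \<Rightarrow> nat) \<Rightarrow> int \<Rightarrow> nat \<Rightarrow> int" where
  "eps n \<tau> \<epsilon>\<^sub>1 j =
     (if j = 1 then \<epsilon>\<^sub>1
      else if j \<in> tau_plus n \<tau> then - 1
      else if j \<in> tau_minus n \<tau> then 1
      else undefined)"

definition word_of_triple :: "int list \<times> (nat \<Rightarrow> nat) \<times> int \<Rightarrow> int list" where
  "word_of_triple = (\<lambda>(i, \<tau>, \<epsilon>\<^sub>1).
     map (\<lambda>j. eps (length i) \<tau> \<epsilon>\<^sub>1 j * letter i (\<tau> j)) [1..<Suc (length i)])"

text \<open>The increasing lists of positions of the positive and of the negative letters.\<close>

definition pos_positions :: "int list \<Rightarrow> nat list" where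
  "pos_positions w = filter (\<lambda>a. letter w a > 0) [1..<Suc (length w)]"

definition neg_positions :: "int list \<Rightarrow> nat list" where
  "neg_positions w = filter (\<lambda>b. letter w b < 0) [1..<Suc (length w)]"

definition unsigned_word :: "int list \<Rightarrow> int list" where
  "unsigned_word w =
     map (letter w) (rev (pos_positions w)) @ map (\<lambda>b. - letter w b) (neg_positions w)"

definition is_word_perm :: "int list \<Rightarrow> (nat \<Rightarrow> nat) \<Rightarrow> bool" where
  "is_word_perm w \<tau> \<longleftrightarrow>
     (let n = length w; m = length (pos_positions w) in
        \<tau> permutes {1..n} \<and>
        (\<forall>t\<in>{1..m}. \<tau> (letter (pos_positions w) t) = m + 1 - t) \<and>
        (\<forall>t\<in>{1..n - m}. \<tau> (letter (neg_positions w) t) = m + t))"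

definition word_perm :: "int list \<Rightarrow> nat \<Rightarrow> nat" where
  "word_perm w = (THE \<tau>. is_word_perm w \<tau>)"

definition triple_of_word :: "int list \<Rightarrow> int list \<times> (nat \<Rightarrow> nat) \<times> int" where
  "triple_of_word w = (unsigned_word w, word_perm w, sgn (letter w 1))"

text \<open>The description of \<open>word_perm\<close> determines a unique permutation for every signed word.\<close>

lemma letter_nonzero:
  assumes "w \<in> signed_words r n" "k \<in> {1..n}"
  shows "letter w k \<noteq> 0"
proof -
  have "letter w k \<in> set w"
    using assms by (auto simp: letter_def signed_words_def)
  then show ?thesis
    using assms(1) by (auto simp: signed_words_def)
qed

lemma set_positions:
  assumes "w \<in> signed_words r n"
  shows "set (pos_positions w) \<union> set (neg_positions w) = {1..n}"
    and "length (pos_positions w) + length (neg_positions w) = n"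
    and "distinct (rev (pos_positions w) @ neg_positions w)"
proof -
  have len: "length w = n"
    using assms by (simp add: signed_words_def)
  show un: "set (pos_positions w) \<union> set (neg_positions w) = {1..n}"
    using letter_nonzero[OF assms]
    by (force simp: pos_positions_def neg_positions_def len)
  show dist: "distinct (rev (pos_positions w) @ neg_positions w)"
    by (auto simp: pos_positions_def neg_positions_def simp del: upt_Suc)
  show "length (pos_positions w) + length (neg_positions w) = n"
    using distinct_card[OF dist] un by simp
qed

lemma ex1_word_perm:
  assumes w: "w \<in> signed_words r n"
  shows "\<exists>!\<tau>. is_word_perm w \<tau>"
proof -
  define P N m where "P = pos_positions w" and "N = neg_positions w" and "m = length P"
  have len: "length w = n"
    using w by (simp add: signed_words_def)
  note pos = set_positions[OF w, folded P_def N_def]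
  have lenN: "length N = n - m" and mn: "m \<le> n"
    using pos(2) by (auto simp: m_def)
  have iff: "is_word_perm w \<tau> \<longleftrightarrow> \<tau> permutes {1..n} \<and>
      (\<forall>t\<in>{1..m}. \<tau> (P ! (t - 1)) = m + 1 - t) \<and>
      (\<forall>t\<in>{1..n - m}. \<tau> (N ! (t - 1)) = m + t)" for \<tau>
    by (simp add: is_word_perm_def Let_def letter_def len P_def N_def m_def)
  define L where "L = rev P @ N"
  define \<sigma> where "\<sigma> k = (if k \<in> {1..n} then L ! (k - 1) else k)" for k
  have L: "length L = n" "distinct L" "set L = {1..n}"
    using pos by (auto simp: L_def)
  have inj: "inj_on \<sigma> {1..n}"
    using L by (auto simp: inj_on_def \<sigma>_def nth_eq_iff_index_eq)
  have "\<sigma> k \<in> {1..n}" if "k \<in> {1..n}" for k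
  proof -
    have "k - 1 < length L"
      using that L(1) by auto
    from nth_mem[OF this] show ?thesis
      using that L(3) by (simp add: \<sigma>_def)
  qed
  then have "\<sigma> ` {1..n} \<subseteq> {1..n}"
    by blast
  then have "\<sigma> ` {1..n} = {1..n}"
    using inj by (simp add: endo_inj_surj)
  then have \<sigma>: "\<sigma> permutes {1..n}"
    using inj by (intro bij_imp_permutes) (auto simp: bij_betw_def \<sigma>_def)
  have "is_word_perm w (inv \<sigma>)"
    unfolding iff
  proof (intro conjI ballI)
    show "inv \<sigma> permutes {1..n}"
      using \<sigma> by (rule permutes_inv)
  next
    fix t assume t: "t \<in> {1..m}"
    then have "\<sigma> (m + 1 - t) = P ! (t - 1)"
      using mn by (auto simp: \<sigma>_def L_def nth_append rev_nth m_def[symmetric] Suc_diff_le)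
    then show "inv \<sigma> (P ! (t - 1)) = m + 1 - t"
      using permutes_inverses(2)[OF \<sigma>] by metis
  next
    fix t assume t: "t \<in> {1..n - m}"
    then have "\<sigma> (m + t) = N ! (t - 1)"
      using mn by (auto simp: \<sigma>_def L_def nth_append m_def[symmetric])
    then show "inv \<sigma> (N ! (t - 1)) = m + t"
      using permutes_inverses(2)[OF \<sigma>] by metis
  qed
  moreover have "\<tau> = \<tau>'" if "is_word_perm w \<tau>" "is_word_perm w \<tau>'" for \<tau> \<tau>'
  proof
    fix k
    consider "k \<in> set P" | "k \<in> set N" | "k \<notin> {1..n}"
      using pos(1) by blast
    then show "\<tau> k = \<tau>' k"
    proof cases
      case 1
      then obtain s where "s < m" "k = P ! s"
        by (auto simp: in_set_conv_nth m_def)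
      then have "Suc s \<in> {1..m}" "k = P ! (Suc s - 1)"
        by auto
      then show ?thesis
        using that unfolding iff by metis
    next
      case 2
      then obtain s where "s < n - m" "k = N ! s"
        by (auto simp: in_set_conv_nth lenN)
      then have "Suc s \<in> {1..n - m}" "k = N ! (Suc s - 1)"
        by auto
      then show ?thesis
        using that unfolding iff by metis
    next
      case 3
      then show ?thesis
        using that unfolding iff by (metis permutes_not_in)
    qed
  qed
  ultimately show ?thesis
    by blast
qed

lemma is_word_perm_word_perm:
  "w \<in> signed_words r n \<Longrightarrow> is_word_perm w (word_perm w)"
  unfolding word_perm_def by (rule theI'[OF ex1_word_perm])

end

theory Submission
  imports Defs
begin

text \<open>
  A permutation \<open>\<tau>\<close> of \<open>{1..n}\<close> maps all initial segments to intervals iff every value \<open>\<tau> k\<close> is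
  smaller than all, or larger than all, of its predecessors \<open>\<tau> 1, \<dots>, \<tau> (k - 1)\<close>. Likewise, \<open>\<tau>\<close> is
  the permutation of a signed word iff \<open>\<tau> k\<close> lies below its predecessors when the \<open>k\<close>-th letter is
  positive and above them when it is negative. Hence the signs of the letters from the second one on
  and the permutation determine each other, and the sign of the first letter is free.
\<close>

section \<open>Permutations sending initial segments to intervals\<close>

lemma mem_Xi_iff:
  "\<tau> \<in> Xi n \<longleftrightarrow> \<tau> permutes {1..n} \<and>
     (\<forall>k\<in>{2..n}. (\<forall>j\<in>{1..<k}. \<tau> k < \<tau> j) \<or> (\<forall>j\<in>{1..<k}. \<tau> j < \<tau> k))"
proof (cases "\<tau> permutes {1..n}")
  case perm: True
  note inj = permutes_inj[OF perm]
  have "(\<forall>j\<in>{1..<k}. \<tau> k < \<tau> j) \<or> (\<forall>j\<in>{1..<k}. \<tau> j < \<tau> k)"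
    if *: "\<forall>j\<in>{1..n}. \<exists>a b. \<tau> ` {1..j} = {a..b}" and k: "k \<in> {2..n}" for k
  proof -
    from k have "k - 1 \<in> {1..n}" and eq: "{1..k - 1} = {1..<k}" by auto
    with * obtain a b where ab: "\<tau> ` {1..<k} = {a..b}" by metis
    \<comment> \<open>By injectivity the interval of earlier values misses \<open>\<tau> k\<close>,
      so \<open>\<tau> k\<close> lies entirely to one side of it.\<close>
    have "\<tau> k \<notin> \<tau> ` {1..<k}" by (auto simp: inj_eq[OF inj])
    then have "\<tau> k < a \<or> b < \<tau> k" using ab by auto
    moreover have "\<tau> j \<in> {a..b}" if "j \<in> {1..<k}" for j
      using that ab by blast
    ultimately show ?thesis by force
  qed
  moreover have "\<exists>a b. \<tau> ` {1..i} = {a..b}"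
    if *: "\<forall>k\<in>{2..n}. (\<forall>j\<in>{1..<k}. \<tau> k < \<tau> j) \<or> (\<forall>j\<in>{1..<k}. \<tau> j < \<tau> k)"
      and i: "i \<in> {1..n}" for i
  proof -
    let ?S = "\<tau> ` {1..i}"
    have fin: "finite ?S" "?S \<noteq> {}" using i by auto
    \<comment> \<open>The interval sought is \<open>{Min ?S..Max ?S}\<close>. A value missing from
      \<open>?S\<close> inside it would be taken at some \<open>k > i\<close>, strictly between the
      values at the predecessors \<open>p\<close> and \<open>q\<close>, contradicting the hypothesis
      at \<open>k\<close>.\<close>
    have "v \<in> ?S" if v: "v \<in> {Min ?S..Max ?S}" for v
    proof -
      obtain p q where pq: "p \<in> {1..i}" "q \<in> {1..i}" "\<tau> p = Min ?S" "\<tau> q = Max ?S"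
        using Min_in[OF fin] Max_in[OF fin] by (metis imageE)
      have "?S \<subseteq> {1..n}"
        using permutes_image[OF perm] i by fastforce
      then have "v \<in> {1..n}"
        using v Min_in[OF fin] Max_in[OF fin] by fastforce
      then obtain k where k: "k \<in> {1..n}" "v = \<tau> k"
        using permutes_image[OF perm] by blast
      show ?thesis
      proof (rule ccontr)
        assume "v \<notin> ?S"
        then have ki: "i < k" using k by force
        then have "(\<forall>j\<in>{1..<k}. \<tau> k < \<tau> j) \<or> (\<forall>j\<in>{1..<k}. \<tau> j < \<tau> k)"
          using * k i by auto
        moreover have "p \<in> {1..<k}" "q \<in> {1..<k}" using pq ki by auto
        ultimately have "\<tau> k < \<tau> p \<or> \<tau> q < \<tau> k" by blast
        moreover have "\<tau> p \<le> \<tau> k" "\<tau> k \<le> \<tau> q"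
          using v unfolding k(2) pq(3,4) by simp_all
        ultimately show False by linarith
      qed
    qed
    moreover have "?S \<subseteq> {Min ?S..Max ?S}" using fin by auto
    ultimately show ?thesis by blast
  qed
  ultimately show ?thesis
    using perm unfolding Xi_def mem_Collect_eq by (intro conj_cong refl iffI ballI)
qed (simp add: Xi_def)

section \<open>The permutation of a signed word\<close>

text \<open>Along the positive positions the prescribed values descend from \<open>m\<close> to
  \<open>1\<close>, along the negative ones they ascend from \<open>m + 1\<close> to
  \<open>n\<close>. Reversing the first list turns both families of equations into one; the
  concatenated list is the one-line notation of the inverse permutation.\<close>

lemma is_word_perm_iff_map:
  assumes w: "w \<in> signed_words r n"
  shows "is_word_perm w \<tau> \<longleftrightarrow> \<tau> permutes {1..n} \<and>
    map \<tau> (rev (pos_positions w) @ neg_positions w) = [1..<Suc n]"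
proof -
  define P N m where "P = pos_positions w" and "N = neg_positions w" and "m = length P"
  have len: "length w = n" using w by (simp add: signed_words_def)
  have lenN: "length N = n - m" "m \<le> n"
    using set_positions(2)[OF w] by (auto simp: P_def N_def m_def)
  \<comment> \<open>The double \<open>rev\<close> mirrors \<open>rev P @ N\<close>, so that
    cancelling one \<open>rev\<close> leaves exactly the equation on \<open>P\<close>.\<close>
  have split: "[1..<Suc n] = rev (rev [1..<Suc m]) @ [Suc m..<Suc n]"
    using lenN(2) upt_add_eq_append[of 1 "Suc m" "n - m"] by (simp del: upt_Suc)
  have P: "map \<tau> P = rev [1..<Suc m] \<longleftrightarrow> (\<forall>t\<in>{1..m}. \<tau> (letter P t) = m + 1 - t)"
    \<comment> \<open>Writing \<open>{1..m}\<close> as the image of \<open>{..<m}\<close> under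
      \<open>Suc\<close> passes from positions counted from 1 to list indices counted from
      0.\<close>
    unfolding image_Suc_lessThan[symmetric]
    by (auto simp: list_eq_iff_nth_eq rev_nth letter_def Suc_diff_Suc
             simp flip: m_def simp del: upt_Suc)
  have N: "map \<tau> N = [Suc m..<Suc n] \<longleftrightarrow> (\<forall>t\<in>{1..n - m}. \<tau> (letter N t) = m + t)"
    unfolding image_Suc_lessThan[symmetric]
    by (auto simp: list_eq_iff_nth_eq lenN letter_def simp del: upt_Suc)
  have "map \<tau> (rev P @ N) = [1..<Suc n] \<longleftrightarrow>
      map \<tau> P = rev [1..<Suc m] \<and> map \<tau> N = [Suc m..<Suc n]"
    unfolding split by (simp add: m_def rev_map[symmetric] del: upt_Suc rev_rev_ident)
  then show ?thesis
    unfolding P N by (simp add: is_word_perm_def Let_def len P_def N_def m_def)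
qed

text \<open>A list with set \<open>{1..n}\<close> equals \<open>[1..<Suc n]\<close> iff it is
  strictly increasing, so only comparisons of values matter. In each of the four sign combinations
  for two positions, the sign at the later one decides the comparison.\<close>

lemma is_word_perm_iff_less:
  assumes w: "w \<in> signed_words r n"
  shows "is_word_perm w \<tau> \<longleftrightarrow> \<tau> permutes {1..n} \<and>
    (\<forall>k\<in>{1..n}. \<forall>j\<in>{1..<k}. (letter w k > 0 \<longrightarrow> \<tau> k < \<tau> j) \<and> (letter w k < 0 \<longrightarrow> \<tau> j < \<tau> k))"
    (is "_ \<longleftrightarrow> _ \<and> ?R")
proof (cases "\<tau> permutes {1..n}")
  case perm: True
  define P N where "P = pos_positions w" and "N = neg_positions w"
  have len: "length w = n" using w by (simp add: signed_words_def)
  have setP: "set P = {k \<in> {1..n}. letter w k > 0}"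
    and setN: "set N = {k \<in> {1..n}. letter w k < 0}"
    by (auto simp: P_def N_def pos_positions_def neg_positions_def len simp del: upt_Suc)
  have sorted: "sorted_wrt (<) P" "sorted_wrt (<) N"
    by (auto simp: P_def N_def pos_positions_def neg_positions_def simp del: upt_Suc
             intro!: sorted_wrt_filter)
  note un = set_positions(1)[OF w, folded P_def N_def]
  have "set (map \<tau> (rev P @ N)) = {1..n}"
    using un permutes_image[OF perm] by (simp flip: image_Un)
  then have "map \<tau> (rev P @ N) = [1..<Suc n] \<longleftrightarrow> sorted_wrt (<) (map \<tau> (rev P @ N))"
    using strict_sorted_equal[of "map \<tau> (rev P @ N)" "[1..<Suc n]"]
    by (auto simp del: upt_Suc simp: atLeastLessThanSuc_atLeastAtMost)
  also have "\<dots> \<longleftrightarrow> sorted_wrt (\<lambda>a b. \<tau> b < \<tau> a) P \<and> sorted_wrt (\<lambda>a b. \<tau> a < \<tau> b) N \<and>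
      (\<forall>p\<in>set P. \<forall>q\<in>set N. \<tau> p < \<tau> q)"
    by (auto simp: sorted_wrt_append sorted_wrt_map sorted_wrt_rev)
  \<comment> \<open>Since \<open>P\<close> is increasing, order in the list is order of positions;
    the same holds for \<open>N\<close> below.\<close>
  also have "sorted_wrt (\<lambda>a b. \<tau> b < \<tau> a) P \<longleftrightarrow> (\<forall>a\<in>set P. \<forall>b\<in>set P. a < b \<longrightarrow> \<tau> b < \<tau> a)"
    using sorted(1) by (induction P) auto
  also have "sorted_wrt (\<lambda>a b. \<tau> a < \<tau> b) N \<longleftrightarrow> (\<forall>a\<in>set N. \<forall>b\<in>set N. a < b \<longrightarrow> \<tau> a < \<tau> b)"
    using sorted(2) by (induction N) auto
  also have "(\<forall>a\<in>set P. \<forall>b\<in>set P. a < b \<longrightarrow> \<tau> b < \<tau> a) \<and>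
      (\<forall>a\<in>set N. \<forall>b\<in>set N. a < b \<longrightarrow> \<tau> a < \<tau> b) \<and>
      (\<forall>p\<in>set P. \<forall>q\<in>set N. \<tau> p < \<tau> q) \<longleftrightarrow> ?R" (is "?L \<longleftrightarrow> _")
  proof
    assume L: ?L
    show ?R
    proof (intro ballI)
      fix k j assume kj: "k \<in> {1..n}" "j \<in> {1..<k}"
      then have "j < k" "j \<in> set P \<union> set N" using un by auto
      then show "(letter w k > 0 \<longrightarrow> \<tau> k < \<tau> j) \<and> (letter w k < 0 \<longrightarrow> \<tau> j < \<tau> k)"
        using L kj(1) unfolding setP setN by blast
    qed
  next
    assume R: ?R
    have pos: "\<tau> k < \<tau> j" if "k \<in> set P" "j \<in> {1..n}" "j < k" for j k
      using R that unfolding setP by auto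
    have neg: "\<tau> j < \<tau> k" if "k \<in> set N" "j \<in> {1..n}" "j < k" for j k
      using R that unfolding setN by auto
    \<comment> \<open>Either of \<open>p\<close> and \<open>q\<close> may come later:
      \<open>pos\<close> settles the case \<open>q < p\<close>, \<open>neg\<close> the case
      \<open>p < q\<close>.\<close>
    have "\<tau> p < \<tau> q" if "p \<in> set P" "q \<in> set N" for p q
    proof -
      have "p \<in> {1..n}" "q \<in> {1..n}" "p \<noteq> q" using that setP setN by auto
      then show ?thesis
        using pos[OF that(1), of q] neg[OF that(2), of p] by linarith
    qed
    with pos neg un show ?L by blast
  qed
  finally show ?thesis
    using perm by (simp add: is_word_perm_iff_map[OF w] P_def N_def)
next
  case False
  then show ?thesis by (simp add: is_word_perm_iff_map[OF w])
qed

lemma word_perm_eqI: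
  "w \<in> signed_words r n \<Longrightarrow> is_word_perm w \<tau> \<Longrightarrow> word_perm w = \<tau>"
  unfolding word_perm_def by (rule the1_equality[OF ex1_word_perm])

section \<open>Letters of the words built by the two maps\<close>

text \<open>Absolute values treat both halves alike, which makes the unsigned word a single map over
  the list occurring in \<open>is_word_perm_iff_map\<close>.\<close>

lemma unsigned_word_eq:
  "unsigned_word w = map (\<lambda>a. \<bar>letter w a\<bar>) (rev (pos_positions w) @ neg_positions w)"
  by (auto simp: unsigned_word_def pos_positions_def neg_positions_def simp del: upt_Suc)

lemma map_letter: "map (letter w) [1..<Suc (length w)] = w"
  by (rule nth_equalityI) (simp_all add: letter_def del: upt_Suc)

lemma letter_unsigned_word:
  assumes w: "w \<in> signed_words r n" and \<tau>: "is_word_perm w \<tau>" and j: "j \<in> {1..n}"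
  shows "letter (unsigned_word w) (\<tau> j) = \<bar>letter w j\<bar>"
proof -
  define L where "L = rev (pos_positions w) @ neg_positions w"
  have L: "map \<tau> L = [1..<Suc n]" "set L = {1..n}"
    using \<tau> set_positions(1)[OF w] by (auto simp: is_word_perm_iff_map[OF w] L_def)
  then obtain k where k: "k < length L" "j = L ! k"
    using j by (metis in_set_conv_nth)
  have "length L = n" using L(1) by (metis length_map length_upt diff_Suc_1)
  \<comment> \<open>The entry of \<open>[1..<Suc n]\<close> at index \<open>k\<close> is
    \<open>Suc k\<close>, so \<open>j\<close> is the \<open>\<tau> j\<close>-th entry of
    \<open>L\<close> when counted from 1.\<close>
  then have "\<tau> j = Suc k"
    using k nth_map[of k L \<tau>] by (simp add: L(1) del: upt_Suc)
  then show ?thesis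
    using k by (simp add: letter_def[of "map _ _"] unsigned_word_eq flip: L_def)
qed

lemma abs_letter_mem:
  assumes "w \<in> signed_words r n" "k \<in> {1..n}"
  shows "\<bar>letter w k\<bar> \<in> {1..int r}"
proof -
  have "letter w k \<in> set w"
    using assms by (auto simp: letter_def signed_words_def)
  then show ?thesis
    using assms(1) by (auto simp: signed_words_def)
qed

lemma letter_word_of_triple:
  assumes "j \<in> {1..length i}"
  shows "letter (word_of_triple (i, \<tau>, e)) j = eps (length i) \<tau> e j * letter i (\<tau> j)"
  using assms by (auto simp: word_of_triple_def letter_def[of "map _ _"] simp del: upt_Suc)

lemma length_word_of_triple [simp]: "length (word_of_triple (i, \<tau>, e)) = length i"
  by (simp add: word_of_triple_def del: upt_Suc)

section \<open>The two maps and their composites\<close>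

lemma triple_of_word_mem:
  assumes w: "w \<in> signed_words r n" and n: "n \<ge> 1"
  shows "triple_of_word w \<in> word_triples r n"
proof -
  note wp = is_word_perm_word_perm[OF w, unfolded is_word_perm_iff_less[OF w]]
  have "word_perm w \<in> Xi n"
    unfolding mem_Xi_iff
  proof (intro conjI ballI)
    fix k assume "k \<in> {2..n}"
    then have k: "k \<in> {1..n}" by auto
    \<comment> \<open>The sign of the nonzero \<open>k\<close>-th letter selects which alternative
      of \<open>mem_Xi_iff\<close> holds at \<open>k\<close>.\<close>
    then have "letter w k > 0 \<or> letter w k < 0"
      using letter_nonzero[OF w k] by linarith
    then show "(\<forall>j\<in>{1..<k}. word_perm w k < word_perm w j) \<or>
        (\<forall>j\<in>{1..<k}. word_perm w j < word_perm w k)"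
      using wp k by blast
  qed (use wp in blast)
  moreover have "length (unsigned_word w) = n"
    using set_positions(2)[OF w] by (simp add: unsigned_word_def)
  moreover have "set (unsigned_word w) \<subseteq> {1..int r}"
  proof -
    have "set (rev (pos_positions w) @ neg_positions w) = {1..n}"
      using set_positions(1)[OF w] by simp
    then show ?thesis
      using abs_letter_mem[OF w] unfolding unsigned_word_eq set_map by blast
  qed
  moreover have "sgn (letter w 1) \<in> {1, -1}"
    using letter_nonzero[OF w, of 1] n by (auto simp: sgn_if)
  ultimately show ?thesis
    by (simp add: triple_of_word_def word_triples_def)
qed

lemma word_of_triple_of_word:
  assumes w: "w \<in> signed_words r n"
  shows "word_of_triple (triple_of_word w) = w"
proof -
  let ?\<tau> = "word_perm w"
  have len: "length w = n" "length (unsigned_word w) = n"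
    using w set_positions(2)[OF w] by (simp_all add: signed_words_def unsigned_word_def)
  note wp = is_word_perm_word_perm[OF w]
  note less = wp[unfolded is_word_perm_iff_less[OF w]]
  \<comment> \<open>For \<open>j > 1\<close>, position 1 is a predecessor of \<open>j\<close>, so
    the sign at \<open>j\<close> can be read off from comparing with \<open>?\<tau> 1\<close> alone.
    Multiplying it by the absolute value then restores the letter.\<close>
  have eps: "eps n ?\<tau> (sgn (letter w 1)) j = sgn (letter w j)" if j: "j \<in> {1..n}" for j
  proof (cases "j = 1")
    case False
    then have 1: "1 \<in> {1..<j}" "j \<in> {2..n}" using j by auto
    have "letter w j \<noteq> 0" using letter_nonzero[OF w j] .
    moreover have "letter w j > 0 \<Longrightarrow> ?\<tau> j < ?\<tau> 1" "letter w j < 0 \<Longrightarrow> ?\<tau> 1 < ?\<tau> j"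
      using less j 1(1) by blast+
    ultimately show ?thesis
      using False 1(2) by (auto simp: eps_def tau_plus_def tau_minus_def sgn_if)
  qed (simp add: eps_def)
  have "word_of_triple (triple_of_word w) =
      map (\<lambda>j. eps n ?\<tau> (sgn (letter w 1)) j * letter (unsigned_word w) (?\<tau> j)) [1..<Suc n]"
    by (simp add: word_of_triple_def triple_of_word_def len del: upt_Suc)
  also have "\<dots> = map (letter w) [1..<Suc n]"
    by (rule map_cong)
       (auto simp: eps letter_unsigned_word[OF w wp] sgn_mult_abs simp del: upt_Suc One_nat_def)
  also have "\<dots> = w" using map_letter[of w] len by simp
  finally show ?thesis .
qed

text \<open>The signs record comparisons with \<open>\<tau> 1\<close> only, but for
  \<open>\<tau>\<close> in \<open>Xi n\<close> this comparison determines those with all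
  predecessors. Hence \<open>\<tau>\<close> satisfies the description of the permutation of the
  word, and uniqueness identifies it with \<open>word_perm\<close>.\<close>

lemma word_of_triple_mem_and_inverse:
  assumes x: "(i, \<tau>, e) \<in> word_triples r n"
  shows "word_of_triple (i, \<tau>, e) \<in> signed_words r n"
    and "n \<ge> 1 \<Longrightarrow> triple_of_word (word_of_triple (i, \<tau>, e)) = (i, \<tau>, e)"
proof -
  define w where "w = word_of_triple (i, \<tau>, e)"
  from x have len: "length i = n" and seti: "set i \<subseteq> {1..int r}" and Xi: "\<tau> \<in> Xi n"
    and e: "e \<in> {1, -1}"
    by (auto simp: word_triples_def)
  have perm: "\<tau> permutes {1..n}" using Xi by (simp add: mem_Xi_iff)
  have lenw: "length w = n" by (simp add: w_def len)
  have letter: "letter w j = eps n \<tau> e j * letter i (\<tau> j)" if "j \<in> {1..n}" for j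
    using that letter_word_of_triple[of j i \<tau> e] by (simp add: len w_def)
  have posi: "letter i (\<tau> j) \<in> {1..int r}" if "j \<in> {1..n}" for j
  proof -
    have "\<tau> j \<in> {1..n}" using permutes_in_image[OF perm] that by blast
    then have "letter i (\<tau> j) \<in> set i" by (auto simp: letter_def len)
    then show ?thesis using seti by blast
  qed
  have eps: "eps n \<tau> e j \<in> {1, -1}" if "j \<in> {1..n}" for j
  proof (cases "j = 1")
    case False
    \<comment> \<open>Injectivity rules out the \<open>undefined\<close> branch of
      \<open>eps\<close>.\<close>
    then have "\<tau> j \<noteq> \<tau> 1" by (simp add: inj_eq[OF permutes_inj[OF perm]])
    then show ?thesis
      using False that by (auto simp: eps_def tau_plus_def tau_minus_def)
  qed (use e in \<open>simp add: eps_def\<close>)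
  have "letter w j \<in> {- int r..- 1} \<union> {1..int r}" if "j \<in> {1..n}" for j
    using eps[OF that] posi[OF that] by (auto simp: letter[OF that])
  then have "letter w ` {1..n} \<subseteq> {- int r..- 1} \<union> {1..int r}" by blast
  moreover have "set w = letter w ` {1..n}"
    by (subst map_letter[symmetric])
       (simp add: lenw atLeastLessThanSuc_atLeastAtMost del: upt_Suc)
  ultimately have w: "w \<in> signed_words r n"
    using lenw by (simp add: signed_words_def)
  then show "word_of_triple (i, \<tau>, e) \<in> signed_words r n" by (simp add: w_def)
  have wp: "is_word_perm w \<tau>"
    unfolding is_word_perm_iff_less[OF w]
  proof (intro conjI ballI impI)
    fix k j assume k: "k \<in> {1..n}" and j: "j \<in> {1..<k}"
    then have k2: "k \<in> {2..n}" "k \<noteq> 1" and 1: "1 \<in> {1..<k}" by auto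
    have cases: "(\<forall>j\<in>{1..<k}. \<tau> k < \<tau> j) \<or> (\<forall>j\<in>{1..<k}. \<tau> j < \<tau> k)"
      using Xi k2(1) unfolding mem_Xi_iff by blast
    \<comment> \<open>As this factor is positive, the sign of \<open>letter w k\<close> is that of
      \<open>eps\<close>. It excludes one alternative in \<open>cases\<close>, evaluated at position
      1, and the other gives the claim for every \<open>j\<close>.\<close>
    have i: "letter i (\<tau> k) > 0" using posi[OF k] by simp
    {
      assume "letter w k > 0"
      then have "\<not> \<tau> 1 < \<tau> k"
        using k2 i by (auto simp: letter[OF k] eps_def tau_plus_def zero_less_mult_iff)
      then show "\<tau> k < \<tau> j" using cases 1 j by blast
    next
      assume "letter w k < 0"
      then have "\<not> \<tau> k < \<tau> 1"
        using k2 i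
        by (auto simp: letter[OF k] eps_def tau_plus_def tau_minus_def mult_less_0_iff)
      then show "\<tau> j < \<tau> k" using cases 1 j by blast
    }
  qed (rule perm)
  define L where "L = rev (pos_positions w) @ neg_positions w"
  have L: "map \<tau> L = [1..<Suc n]" "set L = {1..n}"
    using wp set_positions(1)[OF w] by (auto simp: is_word_perm_iff_map[OF w] L_def)
  have "\<bar>letter w j\<bar> = letter i (\<tau> j)" if "j \<in> {1..n}" for j
    using eps[OF that] posi[OF that] by (auto simp: letter[OF that] abs_mult)
  \<comment> \<open>Along \<open>L\<close> the values of \<open>\<tau>\<close> run through
    \<open>1, ..., n\<close> in order, so the letters of \<open>i\<close> come out in their original
    order.\<close>
  then have "unsigned_word w = map (letter i) (map \<tau> L)"
    using L(2) by (auto simp: unsigned_word_eq simp flip: L_def)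
  also have "\<dots> = i" using map_letter[of i] by (simp add: L(1) len)
  finally have "unsigned_word w = i" .
  moreover have "sgn (letter w 1) = e" if "n \<ge> 1"
    using posi[of 1] e that by (auto simp: letter eps_def sgn_mult)
  ultimately show "triple_of_word (word_of_triple (i, \<tau>, e)) = (i, \<tau>, e)" if "n \<ge> 1"
    using that word_perm_eqI[OF w wp] by (simp add: triple_of_word_def flip: w_def)
qed

theorem lemma5p3p3:
  fixes r n :: nat
  assumes "r \<ge> 1" and "n \<ge> 2"
  shows "bij_betw word_of_triple (word_triples r n) (signed_words r n) \<and>
         (\<forall>w\<in>signed_words r n. triple_of_word w \<in> word_triples r n) \<and>
         (\<forall>x\<in>word_triples r n. triple_of_word (word_of_triple x) = x) \<and>
         (\<forall>w\<in>signed_words r n. word_of_triple (triple_of_word w) = w)"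
proof -
  have n: "n \<ge> 1" using assms(2) by simp
  have ST: "\<forall>x\<in>word_triples r n. triple_of_word (word_of_triple x) = x"
    using word_of_triple_mem_and_inverse(2)[OF _ n] by (metis prod_cases3)
  have TS: "\<forall>w\<in>signed_words r n. word_of_triple (triple_of_word w) = w"
    using word_of_triple_of_word by blast
  have T: "\<forall>w\<in>signed_words r n. triple_of_word w \<in> word_triples r n"
    using triple_of_word_mem[OF _ n] by blast
  have S: "\<forall>x\<in>word_triples r n. word_of_triple x \<in> signed_words r n"
    using word_of_triple_mem_and_inverse(1) by (metis prod_cases3)
  have "bij_betw word_of_triple (word_triples r n) (signed_words r n)"
    using ST TS S T by (intro bij_betw_byWitness[where f' = triple_of_word]) auto
  with ST TS T show ?thesis by blast
qed

end
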